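(* Let $\alpha=\alpha(t)$, $t\in I_1$, and $\omega=\omega(s)$, $s\in I_2$, be self-similar solutions for the curve shortening flow satisfying $\overrightarrow{\kappa_\alpha}=-\alpha^\perp$ and $\overrightarrow{\kappa_\omega}=\omega^\perp$. Then $\alpha\ast\omega:I_1\times I_2\subset\mathbb{R}^2\to\mathbb{C}^2$ given by $$(\alpha\ast\omega)(t,s)=\left(\frac{|\omega(s)|^2-|\alpha(t)|^2}{2}-i(\arg\alpha'(t)+\arg\dot\omega(s)),\ \alpha(t)\omega(s)\right)$$ is a Lagrangian translating soliton for mean curvature flow with translating vector $(1,0)\in\mathbb{C}^2$. By considering the straight lines $\alpha_0(t)=t$ and $\omega_0(s)=s$, the circle $\alpha_1(t)=e^{it}$, together with self-shrinking curves $\alpha_{\mathcal S}$ and self-expanding curves $\omega_{\mathcal E}$, one obtains the following particular examples: (i) $$(\alpha_0\ast\omega_{\mathcal E})(t,s)=\left(\frac{|\omega_{\mathcal E}(s)|^2}{2}-i\arg\dot\omega_{\mathcal E}(s)-\frac{t^2}{2},\ t\,\omega_{\mathcal E}(s)\right),$$ which correspond to the Joyce, Lee and Tsui examples; (ii) $$(\alpha_1\ast\omega_{\mathcal E})(t,s)=\left(\frac{|\omega_{\mathcal E}(s)|^2}{2}-i\arg\dot\omega_{\mathcal E}(s)-it,\ e^{it}\omega_{\mathcal E}(s)\right),$$ for which $\partial_t$ is a Killing vector field; (iii) $$(\alpha_{\mathcal S}\ast\omega_0)(t,s)=\left(\frac{s^2}{2}-\frac{|\alpha_{\mathcal S}(t)|^2}{2}-i\arg\alpha_{\mathcal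 S}'(t),\ \alpha_{\mathcal S}(t)s\right),$$ which satisfies that its Lagrangian angle map is the angle that the tangent vector $\alpha_{\mathcal S}'(t)$ makes with a fixed direction.
   Context: On $\mathbb{C}^2\equiv\mathbb{R}^4$ use the Euclidean metric $\langle\cdot,\cdot\rangle=\mathrm{Re}(z_1\bar w_1+z_2\bar w_2)$, complex structure $J$ (multiplication by $i$), and Kähler form $\langle J\cdot,\cdot\rangle$. An immersion $\phi:M\to\mathbb{C}^2$ of a surface is Lagrangian if the Kähler form pulls back to $0$. If $M$ is oriented with area form $\omega_M$, the Lagrangian angle map $\beta$ is defined (modulo $2\pi$) by $\phi^*(dz_1\wedge dz_2)=e^{i\beta}\omega_M$. $\phi$ is a translating soliton for mean curvature flow with translating vector $\mathbf{e}$ (a nonzero constant vector) if its mean curvature vector $H=\mathrm{trace}\,\sigma$ ($\sigma$ the second fundamental form) satisfies $H=\mathbf{e}^\perp$ (normal projection). Killing fields are with respect to the induced metric. $I_1$ and $I_2$ are intervals of $\mathbb{R}$, and all curves are planar curves in $\mathbb{C}$ parametrized by arc length. For such a curve $\alpha$, $\alpha''=\kappa_\alpha J\alpha'$ defines the curvature, $\overrightarrow{\kappa_\alpha}=\kappa_\alpha J\alpha'$ is the curvature vector, and $\perp$ denotes the component normal to the curve; $'=d/dt$, $\dot{}=d/ds$, and $\arg$ denotes continuous determinations of the argument. A self-shrinking curve $\alpha_{\mathcal S}$ is one with $\overrightarrow{\kappa_{\alpha_{\mathcal S}}}=-\alpha_{\mathcal S}^\perp$, and a self-expanding curve $\omega_{\mathcal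 E}$ is one with $\overrightarrow{\kappa_{\omega_{\mathcal E}}}=\omega_{\mathcal E}^\perp$. In (i)-(iii), $\ast$ denotes the construction displayed in the first part of the claim applied to the indicated curves. The Joyce, Lee and Tsui examples (in dimension two) are the maps $\mathcal F(x,y)=\left(\frac{|w(y)|^2-x^2}{2}-i\theta(y),\ x\,w(y)\right)$, $(x,y)\in\mathbb{R}^2$, where $w$ is a curve in $\mathbb{C}$ whose curvature vector satisfies $\overrightarrow{k}=w^\perp$ and $\theta$ is the angle its tangent vector makes with the $x$-axis.
   Formalization: The soliton claim is stated off the points where α(t)=0=ω(s), where the map is not an immersion (e.g. two lines through 0); in (ii) the displayed map equals α_1∗ω_E only up to the constant translation (-1/2-iπ/2, 0), which is stated explicitly. *)

theory Defs
  imports "HOL-Analysis.Analysis"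
begin

text \<open>
  \<open>\<complex>\<^sup>2\<close> is the type \<open>complex \<times> complex\<close>; its library inner product is
  \<open>Re (z\<^sub>1 * cnj w\<^sub>1 + z\<^sub>2 * cnj w\<^sub>2)\<close>, the Euclidean metric.
\<close>

definition J :: "complex \<times> complex \<Rightarrow> complex \<times> complex"
  where "J v = (\<i> * fst v, \<i> * snd v)"

definition kaehler_form :: "complex \<times> complex \<Rightarrow> complex \<times> complex \<Rightarrow> real"
  where "kaehler_form v w = J v \<bullet> w"

definition normal_part :: "'a::euclidean_space set \<Rightarrow> 'a \<Rightarrow> 'a"
  where "normal_part T v = (THE n. n \<in> T\<^sup>\<bottom> \<and> v - n \<in> T)"

subsection \<open>Plane curves\<close>

definition cderiv :: "real set \<Rightarrow> (real \<Rightarrow> complex) \<Rightarrow> real \<Rightarrow> complex"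
  where "cderiv I \<gamma> t = vector_derivative \<gamma> (at t within I)"

text \<open>Derivatives are one-sided at endpoints that belong to the interval.\<close>

definition arc_length_curve :: "real set \<Rightarrow> (real \<Rightarrow> complex) \<Rightarrow> bool"
  where "arc_length_curve I \<gamma> \<longleftrightarrow>
    is_interval I \<and> interior I \<noteq> {} \<and>
    (\<forall>t\<in>I. \<gamma> differentiable (at t within I)) \<and>
    (\<forall>t\<in>I. cderiv I \<gamma> differentiable (at t within I)) \<and>
    (\<forall>t\<in>I. norm (cderiv I \<gamma> t) = 1)"

definition curvature :: "real set \<Rightarrow> (real \<Rightarrow> complex) \<Rightarrow> real \<Rightarrow> real"
  where "curvature I \<gamma> t =
    (THE \<kappa>. cderiv I (cderiv I \<gamma>) t = \<kappa> *\<^sub>R (\<i> * cderiv I \<gamma> t))"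

definition curvature_vector :: "real set \<Rightarrow> (real \<Rightarrow> complex) \<Rightarrow> real \<Rightarrow> complex"
  where "curvature_vector I \<gamma> t = curvature I \<gamma> t *\<^sub>R (\<i> * cderiv I \<gamma> t)"

definition curve_normal_part :: "real set \<Rightarrow> (real \<Rightarrow> complex) \<Rightarrow> real \<Rightarrow> complex"
  where "curve_normal_part I \<gamma> t = normal_part (span {cderiv I \<gamma> t}) (\<gamma> t)"

definition self_shrinking :: "real set \<Rightarrow> (real \<Rightarrow> complex) \<Rightarrow> bool"
  where "self_shrinking I \<gamma> \<longleftrightarrow> arc_length_curve I \<gamma> \<and>
    (\<forall>t\<in>I. curvature_vector I \<gamma> t = - curve_normal_part I \<gamma> t)"

definition self_expanding :: "real set \<Rightarrow> (real \<Rightarrow> complex) \<Rightarrow> bool"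
  where "self_expanding I \<gamma> \<longleftrightarrow> arc_length_curve I \<gamma> \<and>
    (\<forall>t\<in>I. curvature_vector I \<gamma> t = curve_normal_part I \<gamma> t)"

text \<open>\<open>\<theta>\<close> is, modulo \<open>2\<pi>\<close>, the oriented angle from the direction \<open>d\<close> to \<open>v\<close>.\<close>

definition makes_angle :: "complex \<Rightarrow> complex \<Rightarrow> real \<Rightarrow> bool"
  where "makes_angle d v \<theta> \<longleftrightarrow> sgn v = cis \<theta> * sgn d"

definition tangent_arg :: "real set \<Rightarrow> (real \<Rightarrow> complex) \<Rightarrow> (real \<Rightarrow> real) \<Rightarrow> bool"
  where "tangent_arg I \<gamma> \<theta> \<longleftrightarrow>
    continuous_on I \<theta> \<and> (\<forall>t\<in>I. makes_angle 1 (cderiv I \<gamma> t) (\<theta> t))"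

subsection \<open>Parametrized surfaces\<close>

text \<open>
  A surface is given by global coordinates on a set \<open>M\<close> in the plane. Partial derivatives are
  taken along the coordinate sections of \<open>M\<close>, so that \<open>M\<close> may be a product of intervals with
  endpoints, or a relatively open part of one.
\<close>

definition partial1 ::
    "(real \<times> real) set \<Rightarrow> (real \<times> real \<Rightarrow> 'a::real_normed_vector) \<Rightarrow> real \<times> real \<Rightarrow> 'a"
  where "partial1 M f p =
    vector_derivative (\<lambda>x. f (x, snd p)) (at (fst p) within {x. (x, snd p) \<in> M})"

definition partial2 ::
    "(real \<times> real) set \<Rightarrow> (real \<times> real \<Rightarrow> 'a::real_normed_vector) \<Rightarrow> real \<times> real \<Rightarrow> 'a"
  where "partial2 M f p =
    vector_derivative (\<lambda>y. f (fst p, y)) (at (snd p) within {y. (fst p, y) \<in> M})"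

definition differential ::
    "(real \<times> real) set \<Rightarrow> (real \<times> real \<Rightarrow> 'a::real_normed_vector)
      \<Rightarrow> real \<times> real \<Rightarrow> real \<times> real \<Rightarrow> 'a"
  where "differential M f p u = fst u *\<^sub>R partial1 M f p + snd u *\<^sub>R partial2 M f p"

fun Ck_on ::
    "nat \<Rightarrow> (real \<times> real) set \<Rightarrow> (real \<times> real \<Rightarrow> 'a::real_normed_vector) \<Rightarrow> bool"
  where
    "Ck_on 0 M f \<longleftrightarrow> continuous_on M f"
  | "Ck_on (Suc k) M f \<longleftrightarrow> continuous_on M f \<and>
      (\<forall>p\<in>M. (\<lambda>x. f (x, snd p)) differentiable (at (fst p) within {x. (x, snd p) \<in> M})) \<and>
      (\<forall>p\<in>M. (\<lambda>y. f (fst p, y)) differentiable (at (snd p) within {y. (fst p, y) \<in> M})) \<and>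
      Ck_on k M (partial1 M f) \<and> Ck_on k M (partial2 M f)"

definition smooth_on :: "(real \<times> real) set \<Rightarrow> (real \<times> real \<Rightarrow> 'a::real_normed_vector) \<Rightarrow> bool"
  where "smooth_on M f \<longleftrightarrow> (\<forall>k. Ck_on k M f)"

type_synonym surface_map = "real \<times> real \<Rightarrow> complex \<times> complex"

definition immersion_on :: "(real \<times> real) set \<Rightarrow> surface_map \<Rightarrow> bool"
  where "immersion_on M \<phi> \<longleftrightarrow> smooth_on M \<phi> \<and> (\<forall>p\<in>M. inj (differential M \<phi> p))"

definition tangent_plane :: "(real \<times> real) set \<Rightarrow> surface_map \<Rightarrow> real \<times> real \<Rightarrow> (complex \<times> complex) set"
  where "tangent_plane M \<phi> p = range (differential M \<phi> p)"

definition induced_metric ::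
    "(real \<times> real) set \<Rightarrow> surface_map \<Rightarrow> real \<times> real \<Rightarrow> real \<times> real \<Rightarrow> real \<times> real \<Rightarrow> real"
  where "induced_metric M \<phi> p u v = differential M \<phi> p u \<bullet> differential M \<phi> p v"

definition gram_det :: "(real \<times> real) set \<Rightarrow> surface_map \<Rightarrow> real \<times> real \<Rightarrow> real"
  where "gram_det M \<phi> p = (let g = induced_metric M \<phi> p in
    g (1,0) (1,0) * g (0,1) (0,1) - (g (1,0) (0,1))\<^sup>2)"

definition second_fundamental_form ::
    "(real \<times> real) set \<Rightarrow> surface_map \<Rightarrow> real \<times> real \<Rightarrow> real \<times> real \<Rightarrow> real \<times> real
      \<Rightarrow> complex \<times> complex"
  where "second_fundamental_form M \<phi> p u v =
    normal_part (tangent_plane M \<phi> p) (differential M (\<lambda>q. differential M \<phi> q v) p u)"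

text \<open>The trace \<open>g\<^sup>i\<^sup>j \<sigma>\<^sub>i\<^sub>j\<close>, with the inverse of the \<open>2 \<times> 2\<close> Gram matrix written out.\<close>

definition mean_curvature_vector ::
    "(real \<times> real) set \<Rightarrow> surface_map \<Rightarrow> real \<times> real \<Rightarrow> complex \<times> complex"
  where "mean_curvature_vector M \<phi> p =
    (let g = induced_metric M \<phi> p; \<sigma> = second_fundamental_form M \<phi> p;
         e1 = (1,0); e2 = (0,1)
     in (1 / gram_det M \<phi> p) *\<^sub>R
          (g e2 e2 *\<^sub>R \<sigma> e1 e1 - g e1 e2 *\<^sub>R (\<sigma> e1 e2 + \<sigma> e2 e1) + g e1 e1 *\<^sub>R \<sigma> e2 e2))"

definition lagrangian_on :: "(real \<times> real) set \<Rightarrow> surface_map \<Rightarrow> bool"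
  where "lagrangian_on M \<phi> \<longleftrightarrow> immersion_on M \<phi> \<and>
    (\<forall>p\<in>M. \<forall>u v. kaehler_form (differential M \<phi> p u) (differential M \<phi> p v) = 0)"

definition translating_soliton_on ::
    "(real \<times> real) set \<Rightarrow> complex \<times> complex \<Rightarrow> surface_map \<Rightarrow> bool"
  where "translating_soliton_on M e \<phi> \<longleftrightarrow> immersion_on M \<phi> \<and> e \<noteq> 0 \<and>
    (\<forall>p\<in>M. mean_curvature_vector M \<phi> p = normal_part (tangent_plane M \<phi> p) e)"

definition lagrangian_translating_soliton_on ::
    "(real \<times> real) set \<Rightarrow> complex \<times> complex \<Rightarrow> surface_map \<Rightarrow> bool"
  where "lagrangian_translating_soliton_on M e \<phi> \<longleftrightarrow>
    lagrangian_on M \<phi> \<and> translating_soliton_on M e \<phi>"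

definition dz1_dz2 :: "complex \<times> complex \<Rightarrow> complex \<times> complex \<Rightarrow> complex"
  where "dz1_dz2 v w = fst v * snd w - snd v * fst w"

text \<open>The orientation is the one of the coordinates, in which \<open>\<omega>\<^sub>M = sqrt (det g) dt \<and> ds\<close>.\<close>

definition area_form ::
    "(real \<times> real) set \<Rightarrow> surface_map \<Rightarrow> real \<times> real \<Rightarrow> real \<times> real \<Rightarrow> real \<times> real \<Rightarrow> real"
  where "area_form M \<phi> p u v = sqrt (gram_det M \<phi> p) * (fst u * snd v - snd u * fst v)"

definition lagrangian_angle ::
    "(real \<times> real) set \<Rightarrow> surface_map \<Rightarrow> (real \<times> real \<Rightarrow> real) \<Rightarrow> bool"
  where "lagrangian_angle M \<phi> \<beta> \<longleftrightarrow>
    (\<forall>p\<in>M. \<forall>u v. dz1_dz2 (differential M \<phi> p u) (differential M \<phi> p v)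
                   = cis (\<beta> p) * of_real (area_form M \<phi> p u v))"

text \<open>
  The equation is \<open>L\<^sub>X g = 0\<close>, evaluated on constant coordinate fields \<open>u, v\<close>, for which
  \<open>[X, u] = - D\<^sub>u X\<close>.
\<close>

definition killing_field ::
    "(real \<times> real) set \<Rightarrow> surface_map \<Rightarrow> (real \<times> real \<Rightarrow> real \<times> real) \<Rightarrow> bool"
  where "killing_field M \<phi> X \<longleftrightarrow> smooth_on M X \<and>
    (\<forall>p\<in>M. \<forall>u v.
      differential M (\<lambda>q. induced_metric M \<phi> q u v) p (X p)
      + induced_metric M \<phi> p (differential M X p u) v
      + induced_metric M \<phi> p u (differential M X p v) = 0)"

subsection \<open>The construction\<close>

text \<open>\<open>\<theta>\<close> and \<open>\<psi>\<close> are the chosen determinations of the arguments of the two tangents.\<close>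

definition star ::
    "(real \<Rightarrow> complex) \<Rightarrow> (real \<Rightarrow> real) \<Rightarrow> (real \<Rightarrow> complex) \<Rightarrow> (real \<Rightarrow> real) \<Rightarrow> surface_map"
  where "star \<alpha> \<theta> \<omega> \<psi> = (\<lambda>(t, s).
    (of_real (((norm (\<omega> s))\<^sup>2 - (norm (\<alpha> t))\<^sup>2) / 2) - \<i> * of_real (\<theta> t + \<psi> s), \<alpha> t * \<omega> s))"

text \<open>
  For the curves in question the partial derivatives of the map are \<open>\<alpha>'(t) (- cnj (\<alpha> t), \<omega> s)\<close> and
  \<open>\<omega>'(s) (cnj (\<omega> s), \<alpha> t)\<close>. Both vanish where \<open>\<alpha> t = 0 = \<omega> s\<close>, so it is not an
  immersion at such a point, e.g. for two lines through the origin. The following set is all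
  of \<open>I\<^sub>1 \<times> I\<^sub>2\<close> unless both curves pass through the origin.
\<close>

definition star_domain ::
    "real set \<Rightarrow> (real \<Rightarrow> complex) \<Rightarrow> real set \<Rightarrow> (real \<Rightarrow> complex) \<Rightarrow> (real \<times> real) set"
  where "star_domain I1 \<alpha> I2 \<omega> = {(t, s). t \<in> I1 \<and> s \<in> I2 \<and> (\<alpha> t \<noteq> 0 \<or> \<omega> s \<noteq> 0)}"

definition joyce_lee_tsui_examples :: "surface_map set"
  where "joyce_lee_tsui_examples = {F. \<exists>w \<theta>.
    self_expanding UNIV w \<and> tangent_arg UNIV w \<theta> \<and>
    F = (\<lambda>(x, y). (of_real (((norm (w y))\<^sup>2 - x\<^sup>2) / 2) - \<i> * of_real (\<theta> y), of_real x * w y))}"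

end

theory Submission
  imports Defs
begin

text \<open>
  The curvatures of the two curves are \<open>- Im (\<alpha> * cnj \<alpha>')\<close> and \<open>Im (\<omega> * cnj \<omega>')\<close>, and they are the
  derivatives of the arguments of the tangents. So the first component of the map has the partial
  derivatives \<open>- \<alpha>' * cnj \<alpha>\<close> and \<open>\<omega>' * cnj \<omega>\<close>, and the two coordinate fields of the map,
  \<open>\<alpha>' (- cnj \<alpha>, \<omega>)\<close> and \<open>\<omega>' (cnj \<omega>, \<alpha>)\<close>, are orthogonal for the Hermitian product with common
  square norm \<open>\<lambda> = |\<alpha>|\<^sup>2 + |\<omega>|\<^sup>2\<close>. Hence the map is conformal and Lagrangian, and its Lagrangian angle
  is the argument of \<open>- \<alpha>' \<omega>'\<close>. Its Laplacian is \<open>\<kappa>\<^sub>\<alpha> J F\<^sub>t + \<kappa>\<^sub>\<omega> J F\<^sub>s\<close>, which is the normal part of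
  \<open>\<lambda> (1, 0)\<close> because \<open>\<lambda> (1, 0) = - \<alpha> cnj \<alpha>' F\<^sub>t + \<omega> cnj \<omega>' F\<^sub>s\<close>, where the
  coefficients have imaginary parts \<open>\<kappa>\<^sub>\<alpha>\<close> and \<open>\<kappa>\<^sub>\<omega>\<close>. For the unit circle \<open>\<lambda>\<close> does not depend on \<open>t\<close>, so that \<open>\<partial>\<^sub>t\<close> is a Killing field.
\<close>

subsection \<open>Normal parts\<close>

text \<open>Two candidates differ by a vector lying both in \<open>T\<close> and in its orthogonal
  complement, hence orthogonal to itself and zero.\<close>

lemma normal_part_eqI:
  fixes T :: "'a::euclidean_space set"
  assumes T: "subspace T" and n: "n \<in> T\<^sup>\<bottom>" "v - n \<in> T"
  shows "normal_part T v = n"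
  unfolding normal_part_def
proof (rule the_equality)
  fix m assume m: "m \<in> T\<^sup>\<bottom> \<and> v - m \<in> T"
  have "(v - m) - (v - n) \<in> T"
    using T m n subspace_diff by blast
  moreover have "n - m \<in> T\<^sup>\<bottom>"
    using m n subspace_orthogonal_comp subspace_diff by blast
  ultimately have "orthogonal (n - m) (n - m)"
    by (auto simp: orthogonal_comp_def)
  then show "m = n"
    by (simp add: orthogonal_def)
qed (use n in auto)

text \<open>Existence comes from orthogonal decomposition; by uniqueness, sums and multiples of
  normal parts are again normal parts. Linearity later allows the projection to be taken out of the
  trace in \<open>mean_curvature_vector\<close>.\<close>

lemma linear_normal_part:
  fixes T :: "'a::euclidean_space set"
  assumes T: "subspace T"
  shows "linear (normal_part T)"
proof -
  have ex: "\<exists>n. n \<in> T\<^sup>\<bottom> \<and> v - n \<in> T" for v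
  proof -
    obtain y z where "y \<in> span T" "\<And>w. w \<in> span T \<Longrightarrow> orthogonal z w" "v = y + z"
      using orthogonal_subspace_decomp_exists[of T v] by metis
    then show ?thesis
      using T by (intro exI[of _ z]) (auto simp: orthogonal_comp_def orthogonal_commute span_eq_iff[THEN iffD2])
  qed
  have np: "normal_part T v \<in> T\<^sup>\<bottom>" "v - normal_part T v \<in> T" for v
    using ex[of v] normal_part_eqI[OF T] by metis+
  have sub: "subspace (T\<^sup>\<bottom>)"
    by (rule subspace_orthogonal_comp)
  show ?thesis
  proof (rule linearI)
    fix x y
    have "x + y - (normal_part T x + normal_part T y) = (x - normal_part T x) + (y - normal_part T y)"
      by simp
    then show "normal_part T (x + y) = normal_part T x + normal_part T y"
      by (intro normal_part_eqI T subspace_add[OF sub] np) (simp only: subspace_add[OF T] np)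
  next
    fix r x
    have "r *\<^sub>R x - r *\<^sub>R normal_part T x = r *\<^sub>R (x - normal_part T x)"
      by (simp add: algebra_simps)
    then show "normal_part T (r *\<^sub>R x) = r *\<^sub>R normal_part T x"
      by (intro normal_part_eqI T subspace_scale[OF sub] np) (simp only: subspace_scale[OF T] np)
  qed
qed

subsection \<open>Plane curves\<close>

text \<open>A connected set with more than one point has no isolated points. This makes derivatives
  unique even at endpoints, where they are one-sided.\<close>

lemma interval_at_within_ne_bot:
  fixes I :: "real set"
  assumes "is_interval I" "interior I \<noteq> {}" "t \<in> I"
  shows "at t within I \<noteq> bot"
proof -
  have "I \<noteq> {t}"
    using assms by auto
  then have "t islimpt I"
    using assms by (intro connected_imp_perfect) (auto simp: is_interval_connected)
  then show ?thesis
    by (simp add: trivial_limit_within)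
qed

lemma has_vector_derivative_cderiv:
  assumes "arc_length_curve I \<gamma>" "t \<in> I"
  shows "(\<gamma> has_vector_derivative cderiv I \<gamma> t) (at t within I)"
    and "(cderiv I \<gamma> has_vector_derivative cderiv I (cderiv I \<gamma>) t) (at t within I)"
  using assms vector_derivative_works unfolding arc_length_curve_def cderiv_def by blast+

lemma cderiv_eqI:
  assumes "is_interval I" "interior I \<noteq> {}" "t \<in> I"
    and "(\<gamma> has_vector_derivative D) (at t within I)"
  shows "cderiv I \<gamma> t = D"
  unfolding cderiv_def
  using assms interval_at_within_ne_bot vector_derivative_within by blast

lemma curvature_eqI:
  assumes "cderiv I (cderiv I \<gamma>) t = k *\<^sub>R (\<i> * cderiv I \<gamma> t)" "cderiv I \<gamma> t \<noteq> 0"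
  shows "curvature I \<gamma> t = k"
  unfolding curvature_def using assms by (intro the_equality) (auto dest: sym)

text \<open>Since \<open>z = (z * cnj T) * T\<close>, the real and imaginary parts of the
  coefficient are the tangential and normal components of \<open>z\<close>.\<close>

lemma unit_frame_decomposition:
  assumes "norm T = 1"
  shows "z = Re (z * cnj T) *\<^sub>R T + Im (z * cnj T) *\<^sub>R (\<i> * T)"
proof -
  have "Re w *\<^sub>R T + Im w *\<^sub>R (\<i> * T) = w * T" for w
    by (simp add: complex_eq_iff)
  then have "Re (z * cnj T) *\<^sub>R T + Im (z * cnj T) *\<^sub>R (\<i> * T) = (z * cnj T) * T"
    by blast
  also have "\<dots> = z * (T * cnj T)"
    by (simp only: mult_ac)
  also have "T * cnj T = 1"
    using assms by (simp flip: complex_norm_square)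
  finally show ?thesis
    by simp
qed

text \<open>Differentiating the constant \<open>?T x \<bullet> ?T x\<close> shows that the
  acceleration has no tangential part, so the definite description in \<open>curvature\<close> does
  have a solution.\<close>

lemma cderiv2_arc_length:
  assumes \<gamma>: "arc_length_curve I \<gamma>" and t: "t \<in> I"
  shows "cderiv I (cderiv I \<gamma>) t = curvature I \<gamma> t *\<^sub>R (\<i> * cderiv I \<gamma> t)"
proof -
  let ?T = "cderiv I \<gamma>"
  let ?D = "cderiv I ?T t"
  have unit: "norm (?T x) = 1" if "x \<in> I" for x
    using \<gamma> that by (auto simp: arc_length_curve_def)
  have "((\<lambda>x. ?T x \<bullet> ?T x) has_vector_derivative (?T t \<bullet> ?D + ?D \<bullet> ?T t)) (at t within I)"
    by (intro bounded_bilinear.has_vector_derivative[OF bounded_bilinear_inner]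
          has_vector_derivative_cderiv[OF \<gamma> t])
  then have "((\<lambda>x. 1) has_vector_derivative (?T t \<bullet> ?D + ?D \<bullet> ?T t)) (at t within I)"
    by (rule has_vector_derivative_transform[OF t, rotated]) (simp add: unit flip: power2_norm_eq_inner)
  moreover have "((\<lambda>x. 1::real) has_vector_derivative 0) (at t within I)"
    by simp
  moreover have "at t within I \<noteq> bot"
    using \<gamma> t interval_at_within_ne_bot by (auto simp: arc_length_curve_def)
  ultimately have "?T t \<bullet> ?D + ?D \<bullet> ?T t = 0"
    using vector_derivative_unique_within by blast
  then have "?D \<bullet> ?T t = 0"
    by (simp add: inner_commute)
  then have "Re (?D * cnj (?T t)) = 0"
    by (simp add: inner_complex_def)
  then have D: "?D = Im (?D * cnj (?T t)) *\<^sub>R (\<i> * ?T t)"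
    using unit_frame_decomposition[OF unit[OF t], of ?D] by simp
  then have "curvature I \<gamma> t = Im (?D * cnj (?T t))"
    using unit[OF t] by (intro curvature_eqI) auto
  with D show ?thesis
    by simp
qed

lemma curve_normal_part_arc_length:
  assumes "norm (cderiv I \<gamma> t) = 1"
  shows "curve_normal_part I \<gamma> t = Im (\<gamma> t * cnj (cderiv I \<gamma> t)) *\<^sub>R (\<i> * cderiv I \<gamma> t)"
proof -
  let ?T = "cderiv I \<gamma> t"
  have "\<gamma> t - Im (\<gamma> t * cnj ?T) *\<^sub>R (\<i> * ?T) = Re (\<gamma> t * cnj ?T) *\<^sub>R ?T"
    using unit_frame_decomposition[OF assms, of "\<gamma> t"] by (simp add: diff_eq_eq)
  then have "\<gamma> t - Im (\<gamma> t * cnj ?T) *\<^sub>R (\<i> * ?T) \<in> span {?T}"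
    by (auto simp: span_singleton)
  then show ?thesis
    unfolding curve_normal_part_def
    by (intro normal_part_eqI subspace_span)
      (auto simp: orthogonal_comp_def orthogonal_def span_singleton inner_complex_def algebra_simps)
qed

text \<open>The sign \<epsilon> is -1 for shrinking and 1 for expanding curves, so both equations
  are treated at once, in a scalar form free of normal projections.\<close>

definition self_similar :: "real \<Rightarrow> real set \<Rightarrow> (real \<Rightarrow> complex) \<Rightarrow> bool"
  where "self_similar \<epsilon> I \<gamma> \<longleftrightarrow> arc_length_curve I \<gamma> \<and>
    (\<forall>t\<in>I. curvature I \<gamma> t = \<epsilon> * Im (\<gamma> t * cnj (cderiv I \<gamma> t)))"

lemma self_shrinking_iff: "self_shrinking I \<gamma> \<longleftrightarrow> self_similar (-1) I \<gamma>"
proof -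
  have "curvature_vector I \<gamma> t = - curve_normal_part I \<gamma> t
      \<longleftrightarrow> curvature I \<gamma> t = - Im (\<gamma> t * cnj (cderiv I \<gamma> t))"
    if "norm (cderiv I \<gamma> t) = 1" for t
    using that unfolding curve_normal_part_arc_length[OF that] curvature_vector_def
      scaleR_minus_left[symmetric] scaleR_cancel_right by auto
  then show ?thesis
    unfolding self_shrinking_def self_similar_def arc_length_curve_def mult_minus1 by blast
qed

lemma self_expanding_iff: "self_expanding I \<gamma> \<longleftrightarrow> self_similar 1 I \<gamma>"
proof -
  have "curvature_vector I \<gamma> t = curve_normal_part I \<gamma> t
      \<longleftrightarrow> curvature I \<gamma> t = Im (\<gamma> t * cnj (cderiv I \<gamma> t))"
    if "norm (cderiv I \<gamma> t) = 1" for t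
    using that unfolding curve_normal_part_arc_length[OF that] curvature_vector_def
      scaleR_cancel_right by auto
  then show ?thesis
    unfolding self_expanding_def self_similar_def arc_length_curve_def mult_1 by blast
qed

text \<open>Unit speed as a polynomial identity, the form that algebraic simplification can
  use.\<close>

lemma cderiv_mult_cnj: "arc_length_curve I \<gamma> \<Longrightarrow> t \<in> I \<Longrightarrow> cderiv I \<gamma> t * cnj (cderiv I \<gamma> t) = 1"
  by (simp add: arc_length_curve_def flip: complex_norm_square)

text \<open>
  The continuous determination \<open>\<theta>\<close> is locally \<open>\<theta> t\<close> plus the principal argument of the
  quotient of the tangents, hence differentiable.
\<close>

lemma tangent_arg_has_vector_derivative:
  assumes \<gamma>: "arc_length_curve I \<gamma>" and \<theta>: "tangent_arg I \<gamma> \<theta>" and t: "t \<in> I"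
  shows "(\<theta> has_vector_derivative curvature I \<gamma> t) (at t within I)"
proof -
  let ?T = "cderiv I \<gamma>"
  have T: "?T x = cis (\<theta> x)" if "x \<in> I" for x
  proof -
    have "norm (?T x) = 1"
      using \<gamma> that by (simp add: arc_length_curve_def)
    then show ?thesis
      using \<theta> that by (auto simp: tangent_arg_def makes_angle_def sgn_div_norm)
  qed
  have Arg: "((\<lambda>x. Im (Ln (?T x / ?T t))) has_vector_derivative curvature I \<gamma> t) (at t within I)"
  proof -
    have "((\<lambda>x. ?T x / ?T t) has_vector_derivative curvature I \<gamma> t *\<^sub>R (\<i> * ?T t) / ?T t)
        (at t within I)"
      using has_vector_derivative_cderiv(2)[OF \<gamma> t] cderiv2_arc_length[OF \<gamma> t]
      by (intro has_vector_derivative_divide) simp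
    then have "((\<lambda>x. ?T x / ?T t) has_vector_derivative \<i> * of_real (curvature I \<gamma> t))
        (at t within I)"
      using T[OF t] by (simp add: scaleR_conv_of_real mult.commute)
    \<comment> \<open>The quotient is 1 at the base point, away from the branch cut, whatever the
      direction of the tangent.\<close>
    moreover have "(Ln has_field_derivative 1) (at (?T t / ?T t))"
      using has_field_derivative_Ln[of 1] T[OF t] by simp
    ultimately have "(Ln \<circ> (\<lambda>x. ?T x / ?T t) has_vector_derivative
        \<i> * of_real (curvature I \<gamma> t) * 1) (at t within I)"
      by (rule field_vector_diff_chain_within[OF _ has_field_derivative_at_within])
    then have "((\<lambda>x. Ln (?T x / ?T t)) has_vector_derivative \<i> * of_real (curvature I \<gamma> t))
        (at t within I)"
      by (simp add: o_def)
    from bounded_linear.has_vector_derivative[OF bounded_linear_Im this] show ?thesis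
      by simp
  qed
  have ev: "\<forall>\<^sub>F x in at t within I. Im (Ln (?T x / ?T t)) = \<theta> x - \<theta> t"
  proof -
    have "((\<lambda>x. \<theta> x) \<longlongrightarrow> \<theta> t) (at t within I)"
      using \<theta> t by (auto simp: tangent_arg_def continuous_on_def)
    \<comment> \<open>Within distance \<open>pi\<close> the difference of the arguments is itself a
      principal argument, so no multiple of \<open>2 * pi\<close> intervenes.\<close>
    from tendstoD[OF this pi_gt_zero] have "\<forall>\<^sub>F x in at t within I. dist (\<theta> x) (\<theta> t) < pi" .
    moreover have "\<forall>\<^sub>F x in at t within I. x \<in> I"
      by (simp add: eventually_at_filter)
    ultimately show ?thesis
    proof eventually_elim
      case (elim x)
      then have "?T x / ?T t = exp (\<i> * of_real (\<theta> x - \<theta> t))"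
        using T[OF t] T[of x] by (simp only: cis_divide flip: cis_conv_exp)
      moreover have "Ln (exp (\<i> * of_real (\<theta> x - \<theta> t))) = \<i> * of_real (\<theta> x - \<theta> t)"
        using elim by (intro Ln_exp) (auto simp: dist_real_def)
      ultimately show ?case
        by simp
    qed
  qed
  have "((\<lambda>x. \<theta> x - \<theta> t) has_vector_derivative curvature I \<gamma> t) (at t within I)"
    using Arg unfolding has_vector_derivative_def
    by (rule has_derivative_transform_eventually) (use ev t T[OF t] in auto)
  from has_vector_derivative_add[OF this has_vector_derivative_const[of "\<theta> t"]] show ?thesis
    by simp
qed

text \<open>The first component of the construction is the sum of the two functions differentiated here.\<close>

lemma has_vector_derivative_potential:
  assumes \<gamma>: "self_similar \<epsilon> I \<gamma>" and \<theta>: "tangent_arg I \<gamma> \<theta>" and t: "t \<in> I"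
  shows "((\<lambda>x. of_real (\<epsilon> * (norm (\<gamma> x))\<^sup>2 / 2) - \<i> * of_real (\<theta> x)) has_vector_derivative
      of_real \<epsilon> * cderiv I \<gamma> t * cnj (\<gamma> t)) (at t within I)"
proof -
  let ?T = "cderiv I \<gamma> t"
  have arc: "arc_length_curve I \<gamma>" and \<kappa>: "curvature I \<gamma> t = \<epsilon> * Im (\<gamma> t * cnj ?T)"
    using \<gamma> t by (auto simp: self_similar_def)
  have "((\<lambda>x. \<gamma> x \<bullet> \<gamma> x) has_vector_derivative \<gamma> t \<bullet> ?T + ?T \<bullet> \<gamma> t) (at t within I)"
    by (intro bounded_bilinear.has_vector_derivative[OF bounded_bilinear_inner]
          has_vector_derivative_cderiv[OF arc t])
  then have "((\<lambda>x. (norm (\<gamma> x))\<^sup>2) has_field_derivative 2 * (\<gamma> t \<bullet> ?T)) (at t within I)"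
    by (simp add: power2_norm_eq_inner inner_commute has_real_derivative_iff_has_vector_derivative)
  moreover have "(\<theta> has_field_derivative \<epsilon> * Im (\<gamma> t * cnj ?T)) (at t within I)"
    using tangent_arg_has_vector_derivative[OF arc \<theta> t]
    by (simp add: \<kappa> has_real_derivative_iff_has_vector_derivative)
  ultimately have "((\<lambda>x. of_real (\<epsilon> * (norm (\<gamma> x))\<^sup>2 / 2) - \<i> * of_real (\<theta> x)) has_vector_derivative
      of_real (\<epsilon> * (2 * (\<gamma> t \<bullet> ?T)) / 2) - \<i> * of_real (\<epsilon> * Im (\<gamma> t * cnj ?T))) (at t within I)"
    by (intro has_vector_derivative_diff has_vector_derivative_of_real
        has_vector_derivative_mult_right DERIV_cdivide DERIV_cmult)
  \<comment> \<open>The inner product is the real part of \<open>?T * cnj (\<gamma> t)\<close>, and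
    \<open>Im (\<gamma> t * cnj ?T)\<close> is minus its imaginary part.\<close>
  moreover have "of_real (\<epsilon> * (2 * (\<gamma> t \<bullet> ?T)) / 2) - \<i> * of_real (\<epsilon> * Im (\<gamma> t * cnj ?T))
      = of_real \<epsilon> * ?T * cnj (\<gamma> t)"
    by (simp add: complex_eq_iff inner_complex_def algebra_simps)
  ultimately show ?thesis
    by simp
qed

subsection \<open>Partial derivatives and smoothness\<close>

text \<open>No point of \<open>M\<close> is isolated in its two coordinate sections, which is what
  makes partial derivatives unique.\<close>

definition perfect_sections :: "(real \<times> real) set \<Rightarrow> bool"
  where "perfect_sections M \<longleftrightarrow>
    (\<forall>p\<in>M. at (fst p) within {x. (x, snd p) \<in> M} \<noteq> bot \<and>
            at (snd p) within {y. (fst p, y) \<in> M} \<noteq> bot)"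

text \<open>A relation with explicit candidates, so that partial derivatives can be built up by sum
  and product rules. Continuity is included because \<open>Ck_on\<close> asks for it.\<close>

definition has_partials ::
    "(real \<times> real) set \<Rightarrow> (real \<times> real \<Rightarrow> 'a::real_normed_vector)
      \<Rightarrow> (real \<times> real \<Rightarrow> 'a) \<Rightarrow> (real \<times> real \<Rightarrow> 'a) \<Rightarrow> bool"
  where "has_partials M f f1 f2 \<longleftrightarrow> continuous_on M f \<and>
    (\<forall>p\<in>M. ((\<lambda>x. f (x, snd p)) has_vector_derivative f1 p)
              (at (fst p) within {x. (x, snd p) \<in> M}) \<and>
            ((\<lambda>y. f (fst p, y)) has_vector_derivative f2 p)
              (at (snd p) within {y. (fst p, y) \<in> M}))"

lemma partial_eqI:
  assumes "perfect_sections M" "has_partials M f f1 f2" "p \<in> M"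
  shows "partial1 M f p = f1 p" "partial2 M f p = f2 p"
  using assms unfolding perfect_sections_def has_partials_def partial1_def partial2_def
  by (auto intro!: vector_derivative_within)

lemma differential_eqI:
  assumes "perfect_sections M" "has_partials M f f1 f2" "p \<in> M"
  shows "differential M f p u = fst u *\<^sub>R f1 p + snd u *\<^sub>R f2 p"
  using partial_eqI[OF assms] by (simp add: differential_def)

text \<open>Derivatives are taken within the section, so values outside \<open>M\<close> never
  matter.\<close>

lemma section_derivative_cong:
  assumes "p \<in> M" "\<forall>q\<in>M. f q = g q"
  shows "((\<lambda>x. f (x, snd p)) has_vector_derivative D) (at (fst p) within {x. (x, snd p) \<in> M}) \<longleftrightarrow>
      ((\<lambda>x. g (x, snd p)) has_vector_derivative D) (at (fst p) within {x. (x, snd p) \<in> M})"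
    and "((\<lambda>y. f (fst p, y)) has_vector_derivative D) (at (snd p) within {y. (fst p, y) \<in> M}) \<longleftrightarrow>
      ((\<lambda>y. g (fst p, y)) has_vector_derivative D) (at (snd p) within {y. (fst p, y) \<in> M})"
  using assms
  by - (intro iffI; erule has_vector_derivative_transform[rotated 2]; simp)+

lemma partial_cong:
  assumes "p \<in> M" "\<forall>q\<in>M. f q = g q"
  shows "partial1 M f p = partial1 M g p" "partial2 M f p = partial2 M g p"
  unfolding partial1_def partial2_def vector_derivative_def
    section_derivative_cong[OF assms] by simp_all

lemma has_partials_const: "has_partials M (\<lambda>_. c) (\<lambda>_. 0) (\<lambda>_. 0)"
  by (simp add: has_partials_def)

text \<open>The pair \<open>(a, b)\<close> records which variable the function depends on, so that
  one lemma serves both curves.\<close>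

lemma has_partials_coordinate:
  assumes \<gamma>: "\<And>t. t \<in> I \<Longrightarrow> (\<gamma> has_vector_derivative \<gamma>' t) (at t within I)"
    and \<pi>: "(\<pi>, a, b) \<in> {(fst, 1, 0), (snd, 0, 1)}" "\<pi> ` M \<subseteq> I"
  shows "has_partials M (\<lambda>p. \<gamma> (\<pi> p)) (\<lambda>p. a *\<^sub>R \<gamma>' (\<pi> p)) (\<lambda>p. b *\<^sub>R \<gamma>' (\<pi> p))"
proof -
  have "continuous_on I \<gamma>"
    using \<gamma> has_vector_derivative_continuous unfolding continuous_on_eq_continuous_within by blast
  moreover have "continuous_on M \<pi>"
    using \<pi>(1) by (auto simp: continuous_on_fst[OF continuous_on_id] continuous_on_snd[OF continuous_on_id])
  ultimately have cont: "continuous_on M (\<lambda>p. \<gamma> (\<pi> p))"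
    using \<pi>(2) by (rule continuous_on_compose2)
  from \<pi>(1) consider "\<pi> = fst" "a = 1" "b = 0" | "\<pi> = snd" "a = 0" "b = 1"
    by auto
  then show ?thesis
  proof cases
    case 1
    have "((\<lambda>x. \<gamma> x) has_vector_derivative \<gamma>' (fst p)) (at (fst p) within {x. (x, snd p) \<in> M})"
      if "p \<in> M" for p
      using that \<pi>(2) 1(1) by (intro has_vector_derivative_within_subset[OF \<gamma>]) auto
    with cont 1 show ?thesis
      by (simp add: has_partials_def)
  next
    case 2
    have "((\<lambda>y. \<gamma> y) has_vector_derivative \<gamma>' (snd p)) (at (snd p) within {y. (fst p, y) \<in> M})"
      if "p \<in> M" for p
      using that \<pi>(2) 2(1) by (intro has_vector_derivative_within_subset[OF \<gamma>]) auto
    with cont 2 show ?thesis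
      by (simp add: has_partials_def)
  qed
qed

lemma has_partials_add:
  assumes "has_partials M f f1 f2" "has_partials M g g1 g2"
  shows "has_partials M (\<lambda>p. f p + g p) (\<lambda>p. f1 p + g1 p) (\<lambda>p. f2 p + g2 p)"
  using assms unfolding has_partials_def
  by (simp add: continuous_on_add has_vector_derivative_add)

lemma has_partials_linear:
  assumes "bounded_linear h" "has_partials M f f1 f2"
  shows "has_partials M (\<lambda>p. h (f p)) (\<lambda>p. h (f1 p)) (\<lambda>p. h (f2 p))"
  using assms(2) unfolding has_partials_def
  by (simp add: bounded_linear.continuous_on[OF assms(1)]
      bounded_linear.has_vector_derivative[OF assms(1)])

lemma has_partials_bilinear:
  assumes h: "bounded_bilinear h" and f: "has_partials M f f1 f2" and g: "has_partials M g g1 g2"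
  shows "has_partials M (\<lambda>p. h (f p) (g p)) (\<lambda>p. h (f p) (g1 p) + h (f1 p) (g p))
    (\<lambda>p. h (f p) (g2 p) + h (f2 p) (g p))"
proof -
  have "continuous_on M (\<lambda>p. h (f p) (g p))"
    using f g by (intro bounded_bilinear.continuous_on[OF h]) (auto simp: has_partials_def)
  moreover
  have "((\<lambda>x. h (f (x, snd p)) (g (x, snd p))) has_vector_derivative h (f p) (g1 p) + h (f1 p) (g p))
      (at (fst p) within {x. (x, snd p) \<in> M})" if "p \<in> M" for p
    using bounded_bilinear.has_vector_derivative[OF h, of "\<lambda>x. f (x, snd p)" "f1 p" "fst p" _
        "\<lambda>x. g (x, snd p)" "g1 p"] f g that
    by (auto simp: has_partials_def)
  moreover
  have "((\<lambda>y. h (f (fst p, y)) (g (fst p, y))) has_vector_derivative h (f p) (g2 p) + h (f2 p) (g p))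
      (at (snd p) within {y. (fst p, y) \<in> M})" if "p \<in> M" for p
    using bounded_bilinear.has_vector_derivative[OF h, of "\<lambda>y. f (fst p, y)" "f2 p" "snd p" _
        "\<lambda>y. g (fst p, y)" "g2 p"] f g that
    by (auto simp: has_partials_def)
  ultimately show ?thesis
    by (simp add: has_partials_def)
qed

lemma has_partials_Pair:
  assumes "has_partials M f f1 f2" "has_partials M g g1 g2"
  shows "has_partials M (\<lambda>p. (f p, g p)) (\<lambda>p. (f1 p, g1 p)) (\<lambda>p. (f2 p, g2 p))"
  using assms unfolding has_partials_def
  by (simp add: continuous_on_Pair has_vector_derivative_Pair)

section \<open>The classes \<open>Ck_on\<close> and the operations that preserve them\<close>

lemma differentiable_iff_vector:
  "f differentiable (at x within S) \<longleftrightarrow> (\<exists>D. (f has_vector_derivative D) (at x within S))"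
  by (blast intro: differentiableI_vector dest: vector_derivative_works[THEN iffD1])

lemma Ck_on_cong:
  assumes "\<And>p. p \<in> M \<Longrightarrow> f p = g p"
  shows "Ck_on k M f \<longleftrightarrow> Ck_on k M g"
  using assms
proof (induction k arbitrary: f g)
  case 0
  then show ?case
    using continuous_on_cong by (metis Ck_on.simps(1))
next
  case (Suc k)
  have eq: "\<forall>p\<in>M. f p = g p"
    using Suc.prems by blast
  have "(\<lambda>x. f (x, snd p)) differentiable (at (fst p) within {x. (x, snd p) \<in> M}) \<longleftrightarrow>
      (\<lambda>x. g (x, snd p)) differentiable (at (fst p) within {x. (x, snd p) \<in> M})"
    "(\<lambda>y. f (fst p, y)) differentiable (at (snd p) within {y. (fst p, y) \<in> M}) \<longleftrightarrow>
      (\<lambda>y. g (fst p, y)) differentiable (at (snd p) within {y. (fst p, y) \<in> M})"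
    if "p \<in> M" for p
    unfolding differentiable_iff_vector
      section_derivative_cong[OF that eq] by simp_all
  moreover have "continuous_on M f \<longleftrightarrow> continuous_on M g"
    using Suc.prems by (intro continuous_on_cong) auto
  moreover have "Ck_on k M (partial1 M f) \<longleftrightarrow> Ck_on k M (partial1 M g)"
    "Ck_on k M (partial2 M f) \<longleftrightarrow> Ck_on k M (partial2 M g)"
    by (rule Suc.IH, rule partial_cong[OF _ eq], assumption)+
  ultimately show ?case
    by auto
qed

text \<open>Explicit candidates may stand for the partial derivatives: perfect sections force
  agreement on \<open>M\<close>, and \<open>Ck_on_cong\<close> ignores the rest.\<close>

lemma Ck_on_SucI:
  assumes M: "perfect_sections M" and f: "has_partials M f f1 f2"
    and "Ck_on k M f1" "Ck_on k M f2"
  shows "Ck_on (Suc k) M f"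
proof -
  have "Ck_on k M (partial1 M f)" "Ck_on k M (partial2 M f)"
    using assms Ck_on_cong[OF partial_eqI(1)[OF M f]] Ck_on_cong[OF partial_eqI(2)[OF M f]] by auto
  then show ?thesis
    using f by (auto simp: has_partials_def intro: differentiableI_vector)
qed

lemma Ck_on_SucD:
  assumes "Ck_on (Suc k) M f"
  shows "has_partials M f (partial1 M f) (partial2 M f)"
    and "Ck_on k M (partial1 M f)" "Ck_on k M (partial2 M f)"
  using assms by (auto simp: has_partials_def partial1_def partial2_def vector_derivative_works)

text \<open>Needed for the product rule, where each factor also occurs undifferentiated, one order
  below its own.\<close>

lemma Ck_on_lower: "Ck_on (Suc k) M f \<Longrightarrow> Ck_on k M f"
proof (induction k arbitrary: f)
  case (Suc k)
  have "Ck_on k M (partial1 M f)" "Ck_on k M (partial2 M f)"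
    using Suc.prems by (intro Suc.IH; simp)+
  with Suc.prems show ?case
    by simp
qed simp

lemma Ck_on_const: "perfect_sections M \<Longrightarrow> Ck_on k M (\<lambda>_. c)"
proof (induction k arbitrary: c)
  case (Suc k)
  then show ?case
    by (intro Ck_on_SucI[OF Suc.prems has_partials_const])
qed simp

lemma Ck_on_add:
  assumes M: "perfect_sections M"
  shows "Ck_on k M f \<Longrightarrow> Ck_on k M g \<Longrightarrow> Ck_on k M (\<lambda>p. f p + g p)"
proof (induction k arbitrary: f g)
  case (Suc k)
  show ?case
    by (intro Ck_on_SucI[OF M has_partials_add[OF Ck_on_SucD(1)[OF Suc.prems(1)] Ck_on_SucD(1)[OF Suc.prems(2)]]] Suc.IH Ck_on_SucD(2,3) Suc.prems)
qed (simp add: continuous_on_add)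

lemma Ck_on_linear:
  assumes M: "perfect_sections M" and h: "bounded_linear h"
  shows "Ck_on k M f \<Longrightarrow> Ck_on k M (\<lambda>p. h (f p))"
proof (induction k arbitrary: f)
  case (Suc k)
  show ?case
    by (intro Ck_on_SucI[OF M has_partials_linear[OF h Ck_on_SucD(1)[OF Suc.prems]]] Suc.IH Ck_on_SucD(2,3) Suc.prems)
qed (simp add: bounded_linear.continuous_on[OF h])

lemma Ck_on_bilinear:
  assumes M: "perfect_sections M" and h: "bounded_bilinear h"
  shows "Ck_on k M f \<Longrightarrow> Ck_on k M g \<Longrightarrow> Ck_on k M (\<lambda>p. h (f p) (g p))"
proof (induction k arbitrary: f g)
  case (Suc k)
  show ?case
    by (intro Ck_on_SucI[OF M has_partials_bilinear[OF h Ck_on_SucD(1)[OF Suc.prems(1)] Ck_on_SucD(1)[OF Suc.prems(2)]]] Ck_on_add[OF M] Suc.IH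
          Ck_on_SucD(2,3) Ck_on_lower[OF Suc.prems(1)] Ck_on_lower[OF Suc.prems(2)] Suc.prems)
qed (simp add: bounded_bilinear.continuous_on[OF h])

lemma Ck_on_Pair:
  assumes M: "perfect_sections M"
  shows "Ck_on k M f \<Longrightarrow> Ck_on k M g \<Longrightarrow> Ck_on k M (\<lambda>p. (f p, g p))"
proof (induction k arbitrary: f g)
  case (Suc k)
  show ?case
    by (intro Ck_on_SucI[OF M has_partials_Pair[OF Ck_on_SucD(1)[OF Suc.prems(1)] Ck_on_SucD(1)[OF Suc.prems(2)]]] Suc.IH Ck_on_SucD(2,3) Suc.prems)
qed (simp add: continuous_on_Pair)

text \<open>Bootstrapping: the equation expresses the second derivative polynomially in the curve and its tangent.\<close>

lemma Ck_on_self_similar: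
  fixes a b :: real
  assumes M: "perfect_sections M" and \<gamma>: "self_similar \<epsilon> I \<gamma>"
    and \<pi>: "(\<pi>, a, b) \<in> {(fst, 1, 0), (snd, 0, 1)}" "\<pi> ` M \<subseteq> I"
  shows "Ck_on k M (\<lambda>p. \<gamma> (\<pi> p)) \<and> Ck_on k M (\<lambda>p. cderiv I \<gamma> (\<pi> p))"
proof -
  let ?T = "cderiv I \<gamma>"
  have arc: "arc_length_curve I \<gamma>"
    using \<gamma> by (simp add: self_similar_def)
  note coord = has_partials_coordinate[OF has_vector_derivative_cderiv(1)[OF arc] \<pi>]
    has_partials_coordinate[OF has_vector_derivative_cderiv(2)[OF arc] \<pi>]
  show ?thesis
  proof (induction k)
    case 0
    then show ?case
      using coord by (simp add: has_partials_def)
  next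
    case (Suc k)
    \<comment> \<open>This is curvature times normal with the curvature replaced through the
      self-similar equation; only the curve, its tangent and conjugates occur, all covered by the
      induction hypothesis.\<close>
    have "Ck_on k M (\<lambda>p. of_real (\<epsilon> * Im (\<gamma> (\<pi> p) * cnj (?T (\<pi> p)))) * (\<i> * ?T (\<pi> p)))"
      using Suc.IH
      by (intro Ck_on_bilinear[OF M bounded_bilinear_mult]
          Ck_on_linear[OF M bounded_linear_of_real] Ck_on_linear[OF M bounded_linear_Im]
          Ck_on_linear[OF M bounded_linear_cnj] Ck_on_const[OF M]) auto
    then have "Ck_on k M (\<lambda>p. cderiv I ?T (\<pi> p))"
    proof (rule Ck_on_cong[THEN iffD1, rotated])
      fix p assume "p \<in> M"
      then have "\<pi> p \<in> I"
        using \<pi>(2) by blast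
      then show "of_real (\<epsilon> * Im (\<gamma> (\<pi> p) * cnj (?T (\<pi> p)))) * (\<i> * ?T (\<pi> p)) = cderiv I ?T (\<pi> p)"
        using cderiv2_arc_length[OF arc] \<gamma> by (simp add: self_similar_def scaleR_conv_of_real)
    qed
    then show ?case
      using Suc.IH
      by (intro conjI Ck_on_SucI[OF M coord(1)] Ck_on_SucI[OF M coord(2)]
          Ck_on_linear[OF M bounded_linear_scaleR_right]) auto
  qed
qed

lemma perfect_sections_star_domain:
  assumes \<alpha>: "arc_length_curve I1 \<alpha>" and \<omega>: "arc_length_curve I2 \<omega>"
  shows "perfect_sections (star_domain I1 \<alpha> I2 \<omega>)"
proof -
  \<comment> \<open>\<open>Q\<close> says that the other curve, with its parameter frozen, is off
    the origin. Then the slice is the whole interval; otherwise it is the relatively open set where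
    \<gamma> is nonzero.\<close>
  have slice: "at t within {x \<in> I. \<gamma> x \<noteq> 0 \<or> Q} \<noteq> bot"
    if \<gamma>: "arc_length_curve I \<gamma>" and t: "t \<in> I" "\<gamma> t \<noteq> 0 \<or> Q" for I \<gamma> t Q
  proof
    assume "at t within {x \<in> I. \<gamma> x \<noteq> 0 \<or> Q} = bot"
    then have "\<forall>\<^sub>F x in at t within I. \<not> (\<gamma> x \<noteq> 0 \<or> Q)"
      using eventually_bot[of "\<lambda>_. False"] by (simp add: eventually_at_filter trivial_limit_def)
    moreover have "\<forall>\<^sub>F x in at t within I. \<gamma> x \<noteq> 0 \<or> Q"
    proof (cases Q)
      case False
      have "continuous (at t within I) \<gamma>"
        using has_vector_derivative_cderiv(1)[OF \<gamma> t(1)] by (rule has_vector_derivative_continuous)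
      then show ?thesis
        using tendsto_imp_eventually_ne[of \<gamma> "\<gamma> t" "at t within I" 0] t False
        by (auto simp: continuous_within elim: eventually_mono)
    qed simp
    ultimately have "\<forall>\<^sub>F x in at t within I. False"
      by eventually_elim blast
    then show False
      using interval_at_within_ne_bot[of I t] \<gamma> t(1) by (simp add: arc_length_curve_def trivial_limit_def)
  qed
  have "at t within {x. (x, s) \<in> star_domain I1 \<alpha> I2 \<omega>} \<noteq> bot"
    "at s within {y. (t, y) \<in> star_domain I1 \<alpha> I2 \<omega>} \<noteq> bot"
    if "(t, s) \<in> star_domain I1 \<alpha> I2 \<omega>" for t s
    using that slice[OF \<alpha>, of t "\<omega> s \<noteq> 0"] slice[OF \<omega>, of s "\<alpha> t \<noteq> 0"]
    by (auto simp: star_domain_def disj_commute)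
  then show ?thesis
    by (auto simp: perfect_sections_def)
qed

subsection \<open>The surface\<close>

text \<open>The constant \<open>c\<close> is a translation of the surface. It lets the displayed map
  of example (ii) be an instance.\<close>

locale star_surface =
  fixes I1 :: "real set" and \<alpha> :: "real \<Rightarrow> complex" and \<theta> :: "real \<Rightarrow> real"
    and I2 :: "real set" and \<omega> :: "real \<Rightarrow> complex" and \<psi> :: "real \<Rightarrow> real"
    and c :: "complex \<times> complex"
  assumes \<alpha>: "self_shrinking I1 \<alpha>" and \<theta>: "tangent_arg I1 \<alpha> \<theta>"
    and \<omega>: "self_expanding I2 \<omega>" and \<psi>: "tangent_arg I2 \<omega> \<psi>"
begin

abbreviation "A \<equiv> cderiv I1 \<alpha>"
abbreviation "W \<equiv> cderiv I2 \<omega>"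
abbreviation "M \<equiv> star_domain I1 \<alpha> I2 \<omega>"
definition F :: surface_map
  where "F p = star \<alpha> \<theta> \<omega> \<psi> p + c"

definition F1 :: surface_map
  where "F1 p = (A (fst p) * - cnj (\<alpha> (fst p)), A (fst p) * \<omega> (snd p))"

definition F2 :: surface_map
  where "F2 p = (W (snd p) * cnj (\<omega> (snd p)), W (snd p) * \<alpha> (fst p))"

definition conformal_factor :: "real \<times> real \<Rightarrow> real"
  where "conformal_factor p = (norm (\<alpha> (fst p)))\<^sup>2 + (norm (\<omega> (snd p)))\<^sup>2"

lemma similar: "self_similar (-1) I1 \<alpha>" "self_similar 1 I2 \<omega>"
  using \<alpha> \<omega> by (simp_all add: self_shrinking_iff self_expanding_iff)

lemma arc: "arc_length_curve I1 \<alpha>" "arc_length_curve I2 \<omega>"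
  using similar by (simp_all add: self_similar_def)

lemma coordinates_in:
  assumes "p \<in> M"
  shows "fst p \<in> I1" "snd p \<in> I2"
  using assms by (auto simp: star_domain_def)

lemma projections: "fst ` M \<subseteq> I1" "snd ` M \<subseteq> I2"
  using coordinates_in by blast+

lemma perfect: "perfect_sections M"
  using arc by (rule perfect_sections_star_domain)

lemmas has_partials_fst = has_partials_coordinate[where \<pi> = fst and a = 1 and b = 0,
    OF _ _ projections(1), simplified]
lemmas has_partials_snd = has_partials_coordinate[where \<pi> = snd and a = 0 and b = 1,
    OF _ _ projections(2), simplified]

lemma has_partials_F: "has_partials M F F1 F2"
proof -
  \<comment> \<open>The first component is separated into a function of \<open>t\<close> and one of
    \<open>s\<close>, each of the shape of \<open>has_vector_derivative_potential\<close>, with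
    signs -1 and 1.\<close>
  let ?f = "\<lambda>p. (of_real (-1 * (norm (\<alpha> (fst p)))\<^sup>2 / 2) - \<i> * of_real (\<theta> (fst p))
      + (of_real (1 * (norm (\<omega> (snd p)))\<^sup>2 / 2) - \<i> * of_real (\<psi> (snd p))), \<alpha> (fst p) * \<omega> (snd p)) + c"
  have "F = ?f"
    by (auto simp: F_def star_def fun_eq_iff complex_eq_iff add_divide_distrib diff_divide_distrib algebra_simps
        simp flip: of_real_power)
  \<comment> \<open>Zeros and unit factors are left as the rules produce them, so that the rules
    unify.\<close>
  moreover have "has_partials M ?f
      (\<lambda>p. (of_real (-1) * A (fst p) * cnj (\<alpha> (fst p)) + 0, \<alpha> (fst p) * 0 + A (fst p) * \<omega> (snd p)) + 0)
      (\<lambda>p. (0 + of_real 1 * W (snd p) * cnj (\<omega> (snd p)), \<alpha> (fst p) * W (snd p) + 0 * \<omega> (snd p)) + 0)"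
    by (intro has_partials_add has_partials_Pair has_partials_const has_partials_fst has_partials_snd
        has_partials_bilinear[OF bounded_bilinear_mult]
        has_vector_derivative_potential similar \<theta> \<psi> has_vector_derivative_cderiv arc)
  ultimately show ?thesis
    by (simp add: F1_def[abs_def] F2_def[abs_def] mult.commute)
qed

text \<open>Only the pure second derivatives are computed: in the trace the mixed ones carry the
  factor \<open>g e1 e2\<close>, which is zero for a conformal metric.\<close>

lemma partials2:
  assumes "p \<in> M"
  shows "partial1 M F1 p = (cderiv I1 A (fst p) * - cnj (\<alpha> (fst p)) + A (fst p) * - cnj (A (fst p)),
      cderiv I1 A (fst p) * \<omega> (snd p))"
    and "partial2 M F2 p = (cderiv I2 W (snd p) * cnj (\<omega> (snd p)) + W (snd p) * cnj (W (snd p)),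
      cderiv I2 W (snd p) * \<alpha> (fst p))"
proof -
  note D = has_partials_fst[OF has_vector_derivative_cderiv(1)[OF arc(1)]]
    has_partials_fst[OF has_vector_derivative_cderiv(2)[OF arc(1)]]
    has_partials_snd[OF has_vector_derivative_cderiv(1)[OF arc(2)]]
    has_partials_snd[OF has_vector_derivative_cderiv(2)[OF arc(2)]]
  note mult = has_partials_bilinear[OF bounded_bilinear_mult]
  have "has_partials M F1
      (\<lambda>p. (A (fst p) * - cnj (A (fst p)) + cderiv I1 A (fst p) * - cnj (\<alpha> (fst p)),
            A (fst p) * 0 + cderiv I1 A (fst p) * \<omega> (snd p)))
      (\<lambda>p. (A (fst p) * - cnj 0 + 0 * - cnj (\<alpha> (fst p)), A (fst p) * W (snd p) + 0 * \<omega> (snd p)))"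
    unfolding F1_def[abs_def]
    by (intro has_partials_Pair mult D
        has_partials_linear[OF bounded_linear_minus[OF bounded_linear_cnj]])
  from partial_eqI(1)[OF perfect this assms]
  show "partial1 M F1 p = (cderiv I1 A (fst p) * - cnj (\<alpha> (fst p)) + A (fst p) * - cnj (A (fst p)),
      cderiv I1 A (fst p) * \<omega> (snd p))"
    by simp
  have "has_partials M F2
      (\<lambda>p. (W (snd p) * cnj 0 + 0 * cnj (\<omega> (snd p)), W (snd p) * A (fst p) + 0 * \<alpha> (fst p)))
      (\<lambda>p. (W (snd p) * cnj (W (snd p)) + cderiv I2 W (snd p) * cnj (\<omega> (snd p)),
            W (snd p) * 0 + cderiv I2 W (snd p) * \<alpha> (fst p)))"
    unfolding F2_def[abs_def]
    by (intro has_partials_Pair mult D has_partials_linear[OF bounded_linear_cnj])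
  from partial_eqI(2)[OF perfect this assms]
  show "partial2 M F2 p = (cderiv I2 W (snd p) * cnj (\<omega> (snd p)) + W (snd p) * cnj (W (snd p)),
      cderiv I2 W (snd p) * \<alpha> (fst p))"
    by simp
qed

lemma differential_F: "p \<in> M \<Longrightarrow> differential M F p u = fst u *\<^sub>R F1 p + snd u *\<^sub>R F2 p"
  using perfect has_partials_F by (rule differential_eqI)

text \<open>\<open>F1\<close> and \<open>F2\<close> are products of the curves, their tangents and
  conjugates, all of class \<open>Ck_on\<close> for every order.\<close>

lemma smooth_F: "smooth_on M F"
  unfolding smooth_on_def
proof
  fix k
  have curves: "Ck_on k M (\<lambda>p. \<alpha> (fst p))" "Ck_on k M (\<lambda>p. A (fst p))"
    "Ck_on k M (\<lambda>p. \<omega> (snd p))" "Ck_on k M (\<lambda>p. W (snd p))" for k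
    using Ck_on_self_similar[OF perfect similar(1), of fst 1 0] projections
      Ck_on_self_similar[OF perfect similar(2), of snd 0 1] by auto
  have "Ck_on k M (\<lambda>p. - cnj (\<alpha> (fst p)))" "Ck_on k M (\<lambda>p. cnj (\<omega> (snd p)))"
    by (rule Ck_on_linear[OF perfect _ curves(1)] Ck_on_linear[OF perfect _ curves(3)];
        intro bounded_linear_minus bounded_linear_cnj)+
  then have "Ck_on k M F1" "Ck_on k M F2"
    unfolding F1_def[abs_def] F2_def[abs_def]
    by (simp_all only: Ck_on_Pair[OF perfect] Ck_on_bilinear[OF perfect bounded_bilinear_mult] curves)
  then show "Ck_on k M F"
    by (rule Ck_on_lower[OF Ck_on_SucI[OF perfect has_partials_F]])
qed

text \<open>All values come from the Hermitian products of \<open>F1\<close> and \<open>F2\<close>: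
  real parts give the metric, imaginary parts the Kaehler form up to sign.\<close>

lemma inner_partials:
  assumes "p \<in> M"
  shows "F1 p \<bullet> F1 p = conformal_factor p" "F2 p \<bullet> F2 p = conformal_factor p" "F1 p \<bullet> F2 p = 0"
    and "J (F1 p) \<bullet> F1 p = 0" "J (F2 p) \<bullet> F2 p = 0" "J (F1 p) \<bullet> F2 p = 0" "J (F2 p) \<bullet> F1 p = 0"
proof -
  have inner: "v \<bullet> w = Re (fst v * cnj (fst w) + snd v * cnj (snd w))" for v w :: "complex \<times> complex"
    by (simp add: inner_prod_def inner_complex_def)
  have A: "A (fst p) * cnj (A (fst p)) = 1" and W: "W (snd p) * cnj (W (snd p)) = 1"
    using cderiv_mult_cnj arc coordinates_in[OF assms] by blast+
  have factor: "of_real (conformal_factor p) = \<alpha> (fst p) * cnj (\<alpha> (fst p)) + \<omega> (snd p) * cnj (\<omega> (snd p))"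
    by (simp add: conformal_factor_def complex_norm_square flip: of_real_power)
  have herm: "fst (F1 p) * cnj (fst (F1 p)) + snd (F1 p) * cnj (snd (F1 p)) = of_real (conformal_factor p)"
    "fst (F2 p) * cnj (fst (F2 p)) + snd (F2 p) * cnj (snd (F2 p)) = of_real (conformal_factor p)"
    "fst (F1 p) * cnj (fst (F2 p)) + snd (F1 p) * cnj (snd (F2 p)) = 0"
    "fst (F2 p) * cnj (fst (F1 p)) + snd (F2 p) * cnj (snd (F1 p)) = 0"
    using A W unfolding factor F1_def F2_def fst_conv snd_conv complex_cnj_mult complex_cnj_cnj complex_cnj_minus
    by algebra+
  have J: "J v \<bullet> w = Re (\<i> * (fst v * cnj (fst w) + snd v * cnj (snd w)))" for v w
    by (simp only: inner J_def fst_conv snd_conv algebra_simps)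
  show "F1 p \<bullet> F1 p = conformal_factor p" "F2 p \<bullet> F2 p = conformal_factor p" "F1 p \<bullet> F2 p = 0"
    "J (F1 p) \<bullet> F1 p = 0" "J (F2 p) \<bullet> F2 p = 0" "J (F1 p) \<bullet> F2 p = 0" "J (F2 p) \<bullet> F1 p = 0"
    unfolding J unfolding inner herm by simp_all
qed

lemma conformal_factor_pos: "p \<in> M \<Longrightarrow> conformal_factor p > 0"
  by (auto simp: conformal_factor_def star_domain_def add_pos_nonneg add_nonneg_pos)

lemma induced_metric_F: "p \<in> M \<Longrightarrow> induced_metric M F p u v = conformal_factor p * (u \<bullet> v)"
  unfolding inner_prod_def[of u]
  by (simp add: induced_metric_def differential_F inner_add_left inner_add_right inner_partials
      inner_commute[of "F2 p" "F1 p"] algebra_simps)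

lemma gram_det_F: "p \<in> M \<Longrightarrow> gram_det M F p = (conformal_factor p)\<^sup>2"
  by (simp add: gram_det_def induced_metric_F inner_prod_def power2_eq_square)

text \<open>The induced metric is a positive multiple of the Euclidean one, so no nonzero vector is
  mapped to zero.\<close>

lemma immersion_F: "immersion_on M F"
  unfolding immersion_on_def
proof (intro conjI ballI injI)
  fix p u v assume p: "p \<in> M" and eq: "differential M F p u = differential M F p v"
  have "differential M F p (u - v) = 0"
    using eq by (simp add: differential_F[OF p] algebra_simps)
  then have "induced_metric M F p (u - v) (u - v) = 0"
    by (simp add: induced_metric_def)
  then show "u = v"
    using conformal_factor_pos[OF p] by (simp add: induced_metric_F[OF p])
qed (rule smooth_F)

lemma lagrangian_F: "lagrangian_on M F"
  unfolding lagrangian_on_def kaehler_form_def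
proof (intro conjI ballI allI immersion_F)
  fix p u v assume p: "p \<in> M"
  have J: "J (x *\<^sub>R v + y *\<^sub>R w) = x *\<^sub>R J v + y *\<^sub>R J w" for x y v w
    by (simp add: J_def algebra_simps scaleR_conv_of_real)
  show "J (differential M F p u) \<bullet> differential M F p v = 0"
    unfolding differential_F[OF p] J
    by (simp add: inner_add_left inner_add_right inner_partials[OF p])
qed

text \<open>
  In conformal coordinates \<open>H\<close> is the normal part of the Laplacian divided by the conformal
  factor, and here the Laplacian is already normal.
\<close>

lemma soliton_F: "translating_soliton_on M (1, 0) F"
  unfolding translating_soliton_on_def
proof (intro conjI ballI immersion_F)
  fix p assume p: "p \<in> M"
  let ?T = "tangent_plane M F p" and ?m = "conformal_factor p"
  have T: "?T = {x *\<^sub>R F1 p + y *\<^sub>R F2 p | x y. True}"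
    by (auto simp: tangent_plane_def differential_F[OF p] intro: range_eqI[of _ _ "(x, y)" for x y])
  have sub: "subspace ?T"
  proof -
    have "?T = span {F1 p, F2 p}"
      unfolding T span_insert span_singleton by (auto simp: diff_eq_eq algebra_simps)
    then show ?thesis
      by simp
  qed
  interpret np: linear "normal_part ?T"
    using sub by (rule linear_normal_part)
  let ?a = "\<alpha> (fst p)" and ?A = "A (fst p)" and ?w = "\<omega> (snd p)" and ?W = "W (snd p)"
  note I = coordinates_in[OF p]
  have A: "?A * cnj ?A = 1" and W: "?W * cnj ?W = 1"
    using cderiv_mult_cnj arc I by blast+
  define ka kw where "ka = - Im (?a * cnj ?A)" and "kw = Im (?w * cnj ?W)"
  define N where "N = ka *\<^sub>R J (F1 p) + kw *\<^sub>R J (F2 p)"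
  have dA: "cderiv I1 A (fst p) = of_real ka * (\<i> * ?A)" and dW: "cderiv I2 W (snd p) = of_real kw * (\<i> * ?W)"
    using cderiv2_arc_length[OF arc(1) I(1)] cderiv2_arc_length[OF arc(2) I(2)] similar I
    by (simp_all add: self_similar_def ka_def kw_def scaleR_conv_of_real)
  \<comment> \<open>The summands \<open>- ?A * cnj ?A = -1\<close> and
    \<open>?W * cnj ?W = 1\<close> cancel; this is where the opposite signs in the two halves of the
    construction matter.\<close>
  have sum: "partial1 M F1 p + partial2 M F2 p = N"
    unfolding partials2[OF p] dA dW N_def J_def F1_def F2_def using A W
    by (simp add: scaleR_conv_of_real algebra_simps)
  have Nperp: "N \<in> ?T\<^sup>\<bottom>"
    unfolding N_def orthogonal_comp_def T
    by (auto simp: orthogonal_def inner_add_left inner_add_right inner_partials[OF p] inner_commute[of _ "J _"])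
  have proj: "?m *\<^sub>R (1, 0) - N = (- Re (?a * cnj ?A)) *\<^sub>R F1 p + Re (?w * cnj ?W) *\<^sub>R F2 p"
  proof -
    \<comment> \<open>In the expansion of \<open>?m *\<^sub>R (1, 0)\<close> with complex
      coefficients, the real parts give the tangential component and the imaginary parts give
      \<open>N\<close>.\<close>
    have "of_real (- Re (?a * cnj ?A)) + of_real ka * \<i> = - (?a * cnj ?A)"
      "of_real (Re (?w * cnj ?W)) + of_real kw * \<i> = ?w * cnj ?W"
      by (simp_all add: ka_def kw_def complex_eq_iff)
    moreover have "of_real ?m = ?a * cnj ?a + ?w * cnj ?w"
      by (simp add: conformal_factor_def complex_norm_square flip: of_real_power)
    ultimately show ?thesis
      using A W unfolding N_def J_def F1_def F2_def prod_eq_iff scaleR_conv_of_real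
      by (simp add: scaleR_conv_of_real) algebra
  qed
  have normal: "normal_part ?T (1, 0) = (1 / ?m) *\<^sub>R N"
  proof (rule normal_part_eqI[OF sub])
    show "(1 / ?m) *\<^sub>R N \<in> ?T\<^sup>\<bottom>"
      using Nperp subspace_orthogonal_comp subspace_scale by blast
    have "(1, 0) - (1 / ?m) *\<^sub>R N = (1 / ?m) *\<^sub>R (?m *\<^sub>R (1, 0) - N)"
      using conformal_factor_pos[OF p] by (simp add: algebra_simps)
    moreover have "?m *\<^sub>R (1, 0) - N \<in> ?T"
      unfolding proj T by blast
    ultimately show "(1, 0) - (1 / ?m) *\<^sub>R N \<in> ?T"
      using subspace_scale[OF sub] by simp
  qed
  \<comment> \<open>The second fundamental form differentiates these fields, which are known to
    equal \<open>F1\<close> and \<open>F2\<close> only on \<open>M\<close>; hence the congruence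
    rules.\<close>
  have "\<forall>q\<in>M. differential M F q (1, 0) = F1 q" "\<forall>q\<in>M. differential M F q (0, 1) = F2 q"
    by (simp_all add: differential_F)
  note cong = partial_cong(1)[OF p this(1)] partial_cong(2)[OF p this(2)]
  have "mean_curvature_vector M F p = (1 / ?m\<^sup>2) *\<^sub>R
      (?m *\<^sub>R normal_part ?T (partial1 M F1 p) + ?m *\<^sub>R normal_part ?T (partial2 M F2 p))"
    by (simp add: mean_curvature_vector_def second_fundamental_form_def induced_metric_F[OF p]
        gram_det_F[OF p] inner_prod_def differential_def[of M "\<lambda>q. differential M F q _"] cong)
  also have "\<dots> = (1 / ?m) *\<^sub>R normal_part ?T N"
    using conformal_factor_pos[OF p]
    by (simp add: np.add power2_eq_square flip: sum scaleR_add_right)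
  also have "normal_part ?T N = N"
    using sub Nperp by (intro normal_part_eqI) (auto simp: subspace_0)
  finally show "mean_curvature_vector M F p = normal_part ?T (1, 0)"
    using normal by simp
qed (simp add: zero_prod_def)

lemma lagrangian_soliton_F: "lagrangian_translating_soliton_on M (1, 0) F"
  using lagrangian_F soliton_F by (simp add: lagrangian_translating_soliton_on_def)

text \<open>On \<open>F1\<close> and \<open>F2\<close> the form \<open>dz1_dz2\<close> is
  \<open>- A * W\<close> times the conformal factor, and the area form equals that factor, which is
  positive and cancels.\<close>

lemma lagrangian_angle_F:
  "lagrangian_angle M F \<beta> \<longleftrightarrow> (\<forall>(t, s)\<in>M. cis (\<beta> (t, s)) = - (A t * W s))"
proof -
  have dz: "dz1_dz2 (differential M F p u) (differential M F p v)
      = - (A (fst p) * W (snd p)) * of_real (area_form M F p u v)" if p: "p \<in> M" for p u v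
  proof -
    have "of_real (conformal_factor p) = \<alpha> (fst p) * cnj (\<alpha> (fst p)) + \<omega> (snd p) * cnj (\<omega> (snd p))"
      by (simp add: conformal_factor_def complex_norm_square flip: of_real_power)
    then show ?thesis
      using conformal_factor_pos[OF p]
      by (simp add: dz1_dz2_def area_form_def gram_det_F[OF p] differential_F[OF p] F1_def F2_def
          scaleR_conv_of_real algebra_simps)
  qed
  \<comment> \<open>One pair of arguments with nonzero area suffices to recover
    \<open>cis (\<beta> p)\<close> from the identity for all pairs.\<close>
  have area: "area_form M F p (1, 0) (0, 1) \<noteq> 0" if "p \<in> M" for p
    using conformal_factor_pos[OF that] by (simp add: area_form_def gram_det_F[OF that])
  have "(\<forall>u v. dz1_dz2 (differential M F p u) (differential M F p v)
      = cis (\<beta> p) * of_real (area_form M F p u v)) \<longleftrightarrow> cis (\<beta> p) = - (A (fst p) * W (snd p))"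
    if p: "p \<in> M" for p
    unfolding dz[OF p] using area[OF p] by (metis mult_cancel_right of_real_eq_0_iff)
  then show ?thesis
    by (auto simp: lagrangian_angle_def)
qed

text \<open>The field is constant in coordinates, so only the derivative of the metric along
  \<open>t\<close> remains. It vanishes because the conformal factor depends on \<open>t\<close>
  through the norm of \<alpha> alone.\<close>

lemma killing_field_F:
  assumes "\<And>t t' s. (t, s) \<in> M \<Longrightarrow> (t', s) \<in> M \<Longrightarrow> norm (\<alpha> t') = norm (\<alpha> t)"
  shows "killing_field M F (\<lambda>_. (1, 0))"
  unfolding killing_field_def
proof (intro conjI ballI allI)
  show "smooth_on M (\<lambda>_. (1, 0) :: real \<times> real)"
    unfolding smooth_on_def by (intro allI Ck_on_const[OF perfect])
next
  fix p u v assume p: "p \<in> M"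
  have const: "differential M (\<lambda>_. (1, 0) :: real \<times> real) p w = 0" for w
    using differential_eqI[OF perfect has_partials_const p] by simp
  have "induced_metric M F (x, snd p) u v = induced_metric M F p u v" if "(x, snd p) \<in> M" for x
    using that p assms[of "fst p" "snd p" x] by (simp add: induced_metric_F conformal_factor_def)
  then have "((\<lambda>x. induced_metric M F (x, snd p) u v) has_vector_derivative 0)
      (at (fst p) within {x. (x, snd p) \<in> M})"
    using p by (intro has_vector_derivative_transform[OF _ _ has_vector_derivative_const]) auto
  then have "partial1 M (\<lambda>q. induced_metric M F q u v) p = 0"
    unfolding partial1_def using perfect p
    by (intro vector_derivative_within) (auto simp: perfect_sections_def)
  then have "differential M (\<lambda>q. induced_metric M F q u v) p (1, 0) = 0"
    by (simp add: differential_def[of M "\<lambda>q. induced_metric M F q u v"])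
  moreover have "induced_metric M F p 0 v = 0" "induced_metric M F p u 0 = 0"
    by (simp_all add: induced_metric_F[OF p])
  ultimately show "differential M (\<lambda>q. induced_metric M F q u v) p (1, 0)
      + induced_metric M F p (differential M (\<lambda>_. (1, 0)) p u) v
      + induced_metric M F p u (differential M (\<lambda>_. (1, 0)) p v) = 0"
    unfolding const by simp
qed

end

subsection \<open>Lines and circles\<close>

text \<open>A candidate tangent satisfying the Frenet equation \<open>T' = k \<i> T\<close>
  determines both tangent and curvature; meant for curves given by formulas.\<close>

lemma arc_length_curveI:
  assumes I: "is_interval I" "interior I \<noteq> {}"
    and \<gamma>: "\<And>t. t \<in> I \<Longrightarrow> (\<gamma> has_vector_derivative T t) (at t within I)"
    and T: "\<And>t. t \<in> I \<Longrightarrow> (T has_vector_derivative k t *\<^sub>R (\<i> * T t)) (at t within I)"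
    and unit: "\<And>t. t \<in> I \<Longrightarrow> norm (T t) = 1"
  shows "arc_length_curve I \<gamma>"
    and "t \<in> I \<Longrightarrow> cderiv I \<gamma> t = T t"
    and "t \<in> I \<Longrightarrow> curvature I \<gamma> t = k t"
proof -
  have eq: "cderiv I \<gamma> t = T t" if "t \<in> I" for t
    using cderiv_eqI[OF I that \<gamma>[OF that]] .
  then show "t \<in> I \<Longrightarrow> cderiv I \<gamma> t = T t" .
  have D: "(cderiv I \<gamma> has_vector_derivative k t *\<^sub>R (\<i> * T t)) (at t within I)" if "t \<in> I" for t
    using that eq by (intro has_vector_derivative_transform[OF _ _ T]) auto
  show "arc_length_curve I \<gamma>"
    using I \<gamma> D unit eq by (auto simp: arc_length_curve_def intro: differentiableI_vector)
  show "curvature I \<gamma> t = k t" if "t \<in> I"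
    using cderiv_eqI[OF I that D[OF that]] eq[OF that] unit[OF that] by (intro curvature_eqI) auto
qed

text \<open>The position is real, hence parallel to the tangent 1, and the curvature is zero: both
  sides of the equation vanish for either sign.\<close>

lemma
  assumes I: "is_interval I" "interior I \<noteq> {}"
  shows self_similar_line: "self_similar \<epsilon> I complex_of_real"
    and cderiv_line: "t \<in> I \<Longrightarrow> cderiv I complex_of_real t = 1"
    and tangent_arg_line: "tangent_arg I complex_of_real (\<lambda>_. 0)"
proof -
  have "(complex_of_real has_vector_derivative 1) (at t within I)" for t
    using has_vector_derivative_of_real[OF DERIV_ident] by simp
  note line = arc_length_curveI[where T = "\<lambda>_. 1" and k = "\<lambda>_. 0", OF I this, simplified]
  show "t \<in> I \<Longrightarrow> cderiv I complex_of_real t = 1"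
    by (rule line(2))
  show "self_similar \<epsilon> I complex_of_real" "tangent_arg I complex_of_real (\<lambda>_. 0)"
    using line by (simp_all add: self_similar_def tangent_arg_def makes_angle_def)
qed

text \<open>The tangent is the position turned by a quarter circle, hence the summand
  \<open>pi / 2\<close>. The curvature is 1 and \<open>cis t * cnj (\<i> * cis t)\<close> is
  \<open>- \<i>\<close>, which fits the sign -1.\<close>

lemma
  assumes I: "is_interval I" "interior I \<noteq> {}"
  shows self_similar_circle: "self_similar (-1) I cis"
    and tangent_arg_circle: "tangent_arg I cis (\<lambda>t. t + pi / 2)"
proof -
  have cis: "(cis has_vector_derivative \<i> * cis t) (at t within I)" for t
    using has_derivative_cis[OF has_derivative_ident]
    by (simp add: has_vector_derivative_def scaleR_conv_of_real mult_ac)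
  have "((\<lambda>t. \<i> * cis t) has_vector_derivative 1 *\<^sub>R (\<i> * (\<i> * cis t))) (at t within I)" for t
    using has_vector_derivative_mult_right[OF cis, of \<i>] by simp
  note circle = arc_length_curveI[where T = "\<lambda>t. \<i> * cis t" and k = "\<lambda>_. 1", OF I cis this]
  have "arc_length_curve I cis" "\<And>t. t \<in> I \<Longrightarrow> cderiv I cis t = \<i> * cis t"
    "\<And>t. t \<in> I \<Longrightarrow> curvature I cis t = 1"
    using circle by (simp_all add: norm_mult)
  moreover have "cis t * cnj (cis t) = 1" for t
    by (simp add: cis_cnj cis_mult)
  ultimately show "self_similar (-1) I cis"
    by (simp add: self_similar_def mult.left_commute)
  show "tangent_arg I cis (\<lambda>t. t + pi / 2)"
    using \<open>\<And>t. t \<in> I \<Longrightarrow> cderiv I cis t = \<i> * cis t\<close>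
    by (auto simp: tangent_arg_def makes_angle_def sgn_div_norm norm_mult mult.commute
        simp flip: cis_mult intro!: continuous_intros)
qed

section \<open>The construction in general and its three examples\<close>

theorem corollary1:
  fixes I1 I2 :: "real set"
    and \<alpha> \<omega> :: "real \<Rightarrow> complex"
    and \<theta> \<psi> :: "real \<Rightarrow> real"
  assumes \<alpha>: "self_shrinking I1 \<alpha>" and \<theta>: "tangent_arg I1 \<alpha> \<theta>"
    and \<omega>: "self_expanding I2 \<omega>" and \<psi>: "tangent_arg I2 \<omega> \<psi>"
  shows
    "lagrangian_translating_soliton_on (star_domain I1 \<alpha> I2 \<omega>) (1, 0) (star \<alpha> \<theta> \<omega> \<psi>)

     \<and> \<comment> \<open>(i)\<close>
     (self_shrinking I1 complex_of_real \<and> tangent_arg I1 complex_of_real (\<lambda>_. 0) \<and>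
      (\<forall>t s. star complex_of_real (\<lambda>_. 0) \<omega> \<psi> (t, s) =
        (of_real ((norm (\<omega> s))\<^sup>2 / 2) - \<i> * of_real (\<psi> s) - of_real (t\<^sup>2 / 2), of_real t * \<omega> s)) \<and>
      lagrangian_translating_soliton_on (star_domain I1 complex_of_real I2 \<omega>) (1, 0)
        (star complex_of_real (\<lambda>_. 0) \<omega> \<psi>) \<and>
      {star complex_of_real (\<lambda>_. 0) \<omega>\<^sub>E \<psi>\<^sub>E | \<omega>\<^sub>E \<psi>\<^sub>E.
         self_expanding UNIV \<omega>\<^sub>E \<and> tangent_arg UNIV \<omega>\<^sub>E \<psi>\<^sub>E} = joyce_lee_tsui_examples)

     \<and> \<comment> \<open>(ii), where the displayed map is the construction up to a translation\<close>
     (self_shrinking I1 cis \<and> tangent_arg I1 cis (\<lambda>t. t + pi / 2) \<and>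
      (let F = (\<lambda>(t, s). (of_real ((norm (\<omega> s))\<^sup>2 / 2) - \<i> * of_real (\<psi> s) - \<i> * of_real t,
                          cis t * \<omega> s))
       in (\<forall>t s. star cis (\<lambda>t. t + pi / 2) \<omega> \<psi> (t, s) =
                 F (t, s) + (- of_real (1 / 2) - \<i> * of_real (pi / 2), 0)) \<and>
          lagrangian_translating_soliton_on (I1 \<times> I2) (1, 0) F \<and>
          killing_field (I1 \<times> I2) F (\<lambda>_. (1, 0))))

     \<and> \<comment> \<open>(iii)\<close>
     (self_expanding I2 complex_of_real \<and> tangent_arg I2 complex_of_real (\<lambda>_. 0) \<and>
      (\<forall>t s. star \<alpha> \<theta> complex_of_real (\<lambda>_. 0) (t, s) =
        (of_real (s\<^sup>2 / 2) - of_real ((norm (\<alpha> t))\<^sup>2 / 2) - \<i> * of_real (\<theta> t), \<alpha> t * of_real s)) \<and>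
      lagrangian_translating_soliton_on (star_domain I1 \<alpha> I2 complex_of_real) (1, 0)
        (star \<alpha> \<theta> complex_of_real (\<lambda>_. 0)) \<and>
      (\<exists>d. d \<noteq> 0 \<and>
        (\<forall>\<beta>. lagrangian_angle (star_domain I1 \<alpha> I2 complex_of_real)
                (star \<alpha> \<theta> complex_of_real (\<lambda>_. 0)) \<beta> \<longleftrightarrow>
              (\<forall>(t, s) \<in> star_domain I1 \<alpha> I2 complex_of_real.
                makes_angle d (cderiv I1 \<alpha> t) (\<beta> (t, s))))))"
proof -
  have I1: "is_interval I1" "interior I1 \<noteq> {}" and I2: "is_interval I2" "interior I2 \<noteq> {}"
    using \<alpha> \<omega> by (auto simp: self_shrinking_def self_expanding_def arc_length_curve_def)
  have line1: "self_shrinking I1 complex_of_real" and line2: "self_expanding I2 complex_of_real"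
    and circle: "self_shrinking I1 cis"
    using self_similar_line self_similar_circle I1 I2
    by (auto simp: self_shrinking_iff self_expanding_iff)
  note arg1 = tangent_arg_line[OF I1] and arg2 = tangent_arg_line[OF I2]
    and arg_circle = tangent_arg_circle[OF I1]

  interpret general: star_surface I1 \<alpha> \<theta> I2 \<omega> \<psi> 0
    by standard (rule \<alpha> \<theta> \<omega> \<psi>)+
  interpret i: star_surface I1 complex_of_real "\<lambda>_. 0" I2 \<omega> \<psi> 0
    by standard (rule line1 arg1 \<omega> \<psi>)+
  \<comment> \<open>The translation compensates the constants from \<open>norm (cis t) = 1\<close>
    and from the \<open>pi / 2\<close> in the argument of the tangent.\<close>
  interpret ii: star_surface I1 cis "\<lambda>t. t + pi / 2" I2 \<omega> \<psi> "(1 / 2 + \<i> * of_real (pi / 2), 0)"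
    by standard (rule circle arg_circle \<omega> \<psi>)+
  interpret iii: star_surface I1 \<alpha> \<theta> I2 complex_of_real "\<lambda>_. 0" 0
    by standard (rule \<alpha> \<theta> line2 arg2)+

  have star_i: "star complex_of_real (\<lambda>_. 0) w \<eta> (t, s) =
      (of_real ((norm (w s))\<^sup>2 / 2) - \<i> * of_real (\<eta> s) - of_real (t\<^sup>2 / 2), of_real t * w s)"
    for w \<eta> t s
    by (simp add: star_def diff_divide_distrib)
  \<comment> \<open>For the line the tangent argument is 0 and the squared norm is
    \<open>t\<^sup>2\<close>, so the two families coincide map by map.\<close>
  have jlt: "star complex_of_real (\<lambda>_. 0) w \<eta> =
      (\<lambda>(x, y). (of_real (((norm (w y))\<^sup>2 - x\<^sup>2) / 2) - \<i> * of_real (\<eta> y), of_real x * w y))"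
    for w \<eta>
    by (simp add: star_def)

  let ?F = "\<lambda>(t, s). (of_real ((norm (\<omega> s))\<^sup>2 / 2) - \<i> * of_real (\<psi> s) - \<i> * of_real t, cis t * \<omega> s)"
  have star_ii: "star cis (\<lambda>t. t + pi / 2) \<omega> \<psi> (t, s) =
      ?F (t, s) + (- of_real (1 / 2) - \<i> * of_real (pi / 2), 0)" for t s
    by (simp add: star_def diff_divide_distrib algebra_simps)
  have F_ii: "ii.F = ?F"
    unfolding ii.F_def[abs_def] by (auto simp: star_ii fun_eq_iff)
  \<comment> \<open>The unit circle misses the origin, so no point is removed.\<close>
  have M_ii: "star_domain I1 cis I2 \<omega> = I1 \<times> I2"
    by (auto simp: star_domain_def)

  have star_iii: "star \<alpha> \<theta> complex_of_real (\<lambda>_. 0) (t, s) =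
      (of_real (s\<^sup>2 / 2) - of_real ((norm (\<alpha> t))\<^sup>2 / 2) - \<i> * of_real (\<theta> t), \<alpha> t * of_real s)"
    for t s
    by (simp add: star_def diff_divide_distrib)
  \<comment> \<open>The fixed direction is -1: with tangent 1 on the line, the angle is the argument
    of minus the tangent of \<alpha>.\<close>
  have "lagrangian_angle iii.M iii.F \<beta> \<longleftrightarrow>
      (\<forall>(t, s)\<in>iii.M. makes_angle (-1) (cderiv I1 \<alpha> t) (\<beta> (t, s)))" for \<beta>
  proof -
    have "cis b = - (cderiv I1 \<alpha> t * cderiv I2 complex_of_real s) \<longleftrightarrow>
        makes_angle (-1) (cderiv I1 \<alpha> t) b" if "(t, s) \<in> iii.M" for t s b
    proof -
      have "t \<in> I1" "s \<in> I2"
        using iii.coordinates_in[OF that] by simp_all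
      then have "cderiv I2 complex_of_real s = 1" "sgn (cderiv I1 \<alpha> t) = cderiv I1 \<alpha> t"
        using cderiv_line[OF I2] \<alpha>
        by (simp_all add: self_shrinking_def arc_length_curve_def sgn_div_norm)
      then show ?thesis
        by (auto simp: makes_angle_def sgn_minus)
    qed
    then show ?thesis
      unfolding iii.lagrangian_angle_F by blast
  qed
  then have angle: "\<exists>d. d \<noteq> 0 \<and> (\<forall>\<beta>. lagrangian_angle iii.M iii.F \<beta> \<longleftrightarrow>
      (\<forall>(t, s)\<in>iii.M. makes_angle d (cderiv I1 \<alpha> t) (\<beta> (t, s))))"
    by (intro exI[of _ "-1"]) simp

  have F: "general.F = star \<alpha> \<theta> \<omega> \<psi>" "i.F = star complex_of_real (\<lambda>_. 0) \<omega> \<psi>"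
    "iii.F = star \<alpha> \<theta> complex_of_real (\<lambda>_. 0)"
    by (simp_all add: general.F_def[abs_def] i.F_def[abs_def] iii.F_def[abs_def])
  have soliton_ii: "lagrangian_translating_soliton_on (I1 \<times> I2) (1, 0) ?F"
    and killing: "killing_field (I1 \<times> I2) ?F (\<lambda>_. (1, 0))"
    using ii.lagrangian_soliton_F ii.killing_field_F by (simp_all only: F_ii M_ii norm_cis)
  have jlt_eq: "{star complex_of_real (\<lambda>_. 0) w \<eta> | w \<eta>. self_expanding UNIV w \<and> tangent_arg UNIV w \<eta>}
      = joyce_lee_tsui_examples"
    unfolding joyce_lee_tsui_examples_def jlt by blast
  show ?thesis
    unfolding Let_def
    by (intro conjI allI general.lagrangian_soliton_F[unfolded F] i.lagrangian_soliton_F[unfolded F]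
        iii.lagrangian_soliton_F[unfolded F] angle[unfolded F] soliton_ii killing jlt_eq
        line1 line2 circle arg1 arg2 arg_circle star_i star_ii star_iii)
qed

end
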